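(* The set of rational values $\rho\in(0,1)$ having at least two distinct genuine pairs is dense in $(0,1)$. More precisely, these values may be chosen so that one genuine pair belongs to the apex family and the other belongs to the base family (i.e. the set of rational $\rho\in(0,1)$ having two distinct genuine pairs, one in the apex family and one in the base family, is dense in $(0,1)$).
   Context: A rational triangle is a triangle with rational side lengths (its area need not be rational). For $\rho\in\mathbb{Q}\cap(-1,1)$ let $\theta\in(0,\pi)$ be the angle with $\cos\theta=\rho$. A genuine pair for $\rho$ is a pair $(T,I)$ of non-degenerate rational triangles such that $T$ has an angle equal to $\theta$, $I$ is isosceles, $T$ and $I$ have the same perimeter and the same area, and $T$ and $I$ are not congruent. Genuine pairs are counted up to homothety: $(T,I)$ and $(T',I')$ are regarded as the same pair if there is a common scaling factor $\lambda>0$ such that $T'$ is congruent to $\lambda T$ and $I'$ is congruent to $\lambda I$; otherwise they are distinct. A genuine pair $(T,I)$ belongs to the apex family if $T$ is itself isosceles and $\theta$ is its apex angle (the angle between two equal sides). It belongs to the base family if $T$ is itself isosceles and $\theta$ is one of its base angles (the angles adjacent to the base). *)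

theory Defs
  imports "HOL-Analysis.Analysis"
begin

text \<open>
  A triangle is given by its three vertices in the Euclidean plane. The order of the vertices is
  an artefact of the representation; all predicates on triangles below are invariant under relabelling.
\<close>

type_synonym triangle = "(real ^ 2) \<times> (real ^ 2) \<times> (real ^ 2)"

fun vertices :: "triangle \<Rightarrow> (real ^ 2) set" where
  "vertices (A, B, C) = {A, B, C}"

fun labellings :: "triangle \<Rightarrow> triangle set" where
  "labellings (A, B, C) =
     {(A, B, C), (A, C, B), (B, A, C), (B, C, A), (C, A, B), (C, B, A)}"

definition nondegenerate :: "triangle \<Rightarrow> bool" where
  "nondegenerate T \<longleftrightarrow> \<not> collinear (vertices T)"

fun rational_sides :: "triangle \<Rightarrow> bool" where
  "rational_sides (A, B, C) \<longleftrightarrow> dist A B \<in> \<rat> \<and> dist B C \<in> \<rat> \<and> dist C A \<in> \<rat>"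

fun perimeter :: "triangle \<Rightarrow> real" where
  "perimeter (A, B, C) = dist A B + dist B C + dist C A"

definition area :: "triangle \<Rightarrow> real" where
  "area T = measure lebesgue (convex hull vertices T)"

text \<open>The angle in \<open>[0, pi]\<close> at the middle point \<open>Q\<close>.\<close>

definition angle :: "real ^ 2 \<Rightarrow> real ^ 2 \<Rightarrow> real ^ 2 \<Rightarrow> real" where
  "angle P Q R = arccos ((P - Q) \<bullet> (R - Q) / (norm (P - Q) * norm (R - Q)))"

definition has_angle :: "triangle \<Rightarrow> real \<Rightarrow> bool" where
  "has_angle T \<theta> \<longleftrightarrow> (\<exists>(A, B, C) \<in> labellings T. angle B A C = \<theta>)"

definition isosceles :: "triangle \<Rightarrow> bool" where
  "isosceles T \<longleftrightarrow> (\<exists>(A, B, C) \<in> labellings T. dist A B = dist A C)"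

definition has_apex_angle :: "triangle \<Rightarrow> real \<Rightarrow> bool" where
  "has_apex_angle T \<theta> \<longleftrightarrow>
     (\<exists>(A, B, C) \<in> labellings T. dist A B = dist A C \<and> angle B A C = \<theta>)"

text \<open>The other base angle, at \<open>C\<close>, is covered by the labelling \<open>(A, C, B)\<close>.\<close>

definition has_base_angle :: "triangle \<Rightarrow> real \<Rightarrow> bool" where
  "has_base_angle T \<theta> \<longleftrightarrow>
     (\<exists>(A, B, C) \<in> labellings T. dist A B = dist A C \<and> angle A B C = \<theta>)"

text \<open>Congruence is by isometries of the plane, reflections included.\<close>

definition congruent :: "triangle \<Rightarrow> triangle \<Rightarrow> bool" where
  "congruent T T' \<longleftrightarrow>
     (\<exists>f :: real ^ 2 \<Rightarrow> real ^ 2.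
        (\<forall>x y. dist (f x) (f y) = dist x y) \<and> f ` vertices T = vertices T')"

fun scale_triangle :: "real \<Rightarrow> triangle \<Rightarrow> triangle" where
  "scale_triangle c (A, B, C) = (c *\<^sub>R A, c *\<^sub>R B, c *\<^sub>R C)"

text \<open>For \<open>-1 < \<rho> < 1\<close>, \<open>arccos \<rho>\<close> is the angle in \<open>(0, pi)\<close> with cosine \<open>\<rho>\<close>.\<close>

fun genuine_pair :: "real \<Rightarrow> triangle \<times> triangle \<Rightarrow> bool" where
  "genuine_pair \<rho> (T, I) \<longleftrightarrow>
     nondegenerate T \<and> rational_sides T \<and> nondegenerate I \<and> rational_sides I \<and>
     has_angle T (arccos \<rho>) \<and> isosceles I \<and>
     perimeter T = perimeter I \<and> area T = area I \<and> \<not> congruent T I"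

fun same_pair :: "triangle \<times> triangle \<Rightarrow> triangle \<times> triangle \<Rightarrow> bool" where
  "same_pair (T, I) (T', I') \<longleftrightarrow>
     (\<exists>c > 0. congruent T' (scale_triangle c T) \<and> congruent I' (scale_triangle c I))"

definition apex_family :: "real \<Rightarrow> triangle \<times> triangle \<Rightarrow> bool" where
  "apex_family \<rho> p \<longleftrightarrow> genuine_pair \<rho> p \<and> has_apex_angle (fst p) (arccos \<rho>)"

definition base_family :: "real \<Rightarrow> triangle \<times> triangle \<Rightarrow> bool" where
  "base_family \<rho> p \<longleftrightarrow> genuine_pair \<rho> p \<and> has_base_angle (fst p) (arccos \<rho>)"

end

theory Submission
  imports Defs
begin

text \<open>
  Scale the perimeter to 2. An isosceles triangle with base \<open>2 b\<close> then has legs \<open>1 - b\<close> and squared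
  area \<open>b\<^sup>2 (1 - 2 b)\<close>. Equating this with \<open>b'\<^sup>2 (1 - 2 b')\<close> and dividing by \<open>b - b'\<close> leaves a quadratic
  equation for \<open>b'\<close>; in terms of the cosine \<open>u = b / (1 - b)\<close> of the base angle it has a rational
  solution exactly when \<open>(1 - u) (1 + 7 u)\<close> is a rational square, and then the triangle has a
  non-congruent isosceles partner as soon as \<open>u \<noteq> 1/2\<close>, that is, unless it is equilateral
  (\<open>equal_area_partner\<close>).

  The cosine of the apex angle is \<open>1 - 2 u\<^sup>2\<close>. Hence \<open>\<rho> = 1 - 2 u\<^sup>2\<close> carries an apex pair if
  \<open>(1 - u) (1 + 7 u)\<close> is a square, and it carries a base pair if
  \<open>(1 - \<rho>) (1 + 7 \<rho>) = 4 u\<^sup>2 (4 - 7 u\<^sup>2)\<close> is one. So the task is to find a dense set of \<open>u\<close> for which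
  \<open>(1 - u) (1 + 7 u)\<close> and \<open>4 - 7 u\<^sup>2\<close> are both squares: rational points on an intersection of two
  quadrics, a curve of genus one.

  That curve is birational to the quartic \<open>y\<^sup>2 = 1 + 70 x\<^sup>2 - 567 x\<^sup>4\<close> (see \<open>base_cos_squares\<close>), an elliptic
  curve of positive rank with connected real locus, so its rational points are dense among the real ones.
  The density has an elementary proof, because the group law
  \<open>(x\<^sub>1 y\<^sub>2 + x\<^sub>2 y\<^sub>1) / (1 + 567 x\<^sub>1\<^sup>2 x\<^sub>2\<^sup>2)\<close> of Euler's addition theorem has a denominator without real zeros. Doubling a point of positive
  2-adic order raises that order by one, which gives infinitely many rational points
  (\<open>sq_points_sequence\<close>). They accumulate, and differences of nearby points are rational points with arbitrarily
  small \<open>x > 0\<close> (\<open>small_sq_point\<close>). Adding such a point over and over moves to the right in small steps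
  that are bounded below, hence walks through the whole interval \<open>[0, 1/3]\<close> (\<open>sq_points_dense\<close>). On this interval \<open>\<rho>\<close>
  runs continuously from \<open>1\<close> to \<open>-1/8\<close> and so takes all values in \<open>(0, 1)\<close>.
\<close>

section \<open>The group of rational points on the quartic\<close>

text \<open>
  Euler's addition theorem for \<open>dx / sqrt (1 + a x\<^sup>2 + c x\<^sup>4)\<close>. Once \<open>y\<^sub>1\<^sup>2\<close> and \<open>y\<^sub>2\<^sup>2\<close> are
  eliminated, both sides are polynomials in \<open>x\<^sub>1\<close>, \<open>x\<^sub>2\<close> and the single product \<open>y\<^sub>1 y\<^sub>2\<close>.
\<close>

lemma euler_addition:
  fixes x1 x2 y1 y2 a c :: "'a::field"
  assumes y1: "y1^2 = 1 + a * x1^2 + c * x1^4" and y2: "y2^2 = 1 + a * x2^2 + c * x2^4"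
    and d: "d = 1 - c * x1^2 * x2^2" "d \<noteq> 0"
  shows "((((y1*y2 + a*x1*x2) * (1 + c*x1^2*x2^2) + 2*c*x1*x2*(x1^2 + x2^2)) / d^2)^2
     = 1 + a * ((x1*y2 + x2*y1)/d)^2 + c * ((x1*y2 + x2*y1)/d)^4)"
proof -
  define t where "t = y1 * y2"
  define f1 where "f1 = 1 + a * x1^2 + c * x1^4"
  define f2 where "f2 = 1 + a * x2^2 + c * x2^4"
  have t2: "t^2 = f1 * f2" by (simp add: t_def power_mult_distrib y1 y2 f1_def f2_def)
  define A where "A = x1^2 * f2 + x2^2 * f1"
  have n: "(x1*y2 + x2*y1)^2 = A + 2*x1*x2*t"
    using y1 y2 unfolding t_def A_def f1_def f2_def by algebra
  have n4: "(x1*y2 + x2*y1)^4 = (A + 2*x1*x2*t)^2"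
    unfolding n[symmetric] by (simp flip: power_mult)
  have key: "((t + a*x1*x2) * (1 + c*x1^2*x2^2) + 2*c*x1*x2*(x1^2 + x2^2))^2
      = d^4 + a * (A + 2*x1*x2*t) * d^2 + c * (A + 2*x1*x2*t)^2"
    using t2 unfolding A_def f1_def f2_def d(1) by algebra
  show ?thesis
    using d(2) key unfolding t_def[symmetric]
    by (simp add: power_divide n n4 field_simps flip: power_mult)
qed

lemma Rats_square_Ints:
  fixes y :: real
  assumes "y \<in> \<rat>" "y^2 \<in> \<int>" shows "y \<in> \<int>"
proof -
  obtain m n :: nat where mn: "n \<noteq> 0" "\<bar>y\<bar> = of_nat m / of_nat n" "coprime m n"
    using assms(1) by (rule Rats_abs_nat_div_natE)
  obtain k where k: "y^2 = of_int k" using assms(2) by (auto elim: Ints_cases)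
  have "(of_nat m / of_nat n)^2 = (of_int k :: real)" using k mn(2) by (metis power2_abs)
  then have "(of_int (int m ^ 2) :: real) = of_int (k * int n ^ 2)"
    using mn(1) by (simp add: field_simps)
  then have "int m ^ 2 = k * int n ^ 2" by (rule of_int_eq_iff[THEN iffD1])
  then have "int n ^ 2 dvd int m ^ 2" by simp
  then have "n dvd m" by (simp flip: int_dvd_int_iff)
  then have "n = 1" using mn(3) by (metis coprime_common_divisor_nat dvd_refl nat_dvd_1_iff_1)
  then have "\<bar>y\<bar> \<in> \<int>" using mn(2) by simp
  then show ?thesis by (simp add: abs_if split: if_splits)
qed

text \<open>The \<open>x\<close>-coordinates of the rational points on the quartic.\<close>

definition sq_points :: "real set" where
  "sq_points = {x \<in> \<rat>. \<exists>y \<in> \<rat>. y^2 = 1 + 70 * x^2 - 567 * x^4}"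

lemma sq_points_add:
  assumes "x1 \<in> \<rat>" "x2 \<in> \<rat>" "y1 \<in> \<rat>" "y2 \<in> \<rat>"
   "y1^2 = 1 + 70 * x1^2 - 567 * x1^4" "y2^2 = 1 + 70 * x2^2 - 567 * x2^4"
  shows "(x1*y2 + x2*y1) / (1 + 567 * x1^2 * x2^2) \<in> sq_points"
proof -
  have pos: "1 + 567 * x1^2 * x2^2 > 0"
    by (intro add_pos_nonneg mult_nonneg_nonneg) auto
  have "((((y1*y2 + 70*x1*x2) * (1 + (-567)*x1^2*x2^2) + 2*(-567)*x1*x2*(x1^2 + x2^2)) / (1 + 567 * x1^2 * x2^2)^2)^2
     = 1 + 70 * ((x1*y2 + x2*y1)/(1 + 567 * x1^2 * x2^2))^2 + (-567) * ((x1*y2 + x2*y1)/(1 + 567 * x1^2 * x2^2))^4)"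
    by (rule euler_addition) (use assms pos in auto)
  then show ?thesis
    unfolding sq_points_def using assms(1-4)
    by (intro CollectI conjI bexI[of _ "((y1*y2 + 70*x1*x2) * (1 + (-567)*x1^2*x2^2) + 2*(-567)*x1*x2*(x1^2 + x2^2)) / (1 + 567 * x1^2 * x2^2)^2"]) auto
qed

lemma quartic_ge_1:
  fixes r :: real assumes "0 \<le> r" "r \<le> 1/3" shows "1 \<le> 1 + 70 * r^2 - 567 * r^4"
proof -
  have "r^2 \<le> 1/9" using power_mono[OF assms(2,1), of 2] by (simp add: power_divide)
  then have "0 \<le> r^2 * (70 - 567 * r^2)" by simp
  then show ?thesis by (simp add: algebra_simps flip: power_add)
qed

lemma sq_pointsE:
  assumes "x \<in> sq_points"
  obtains y where "x \<in> \<rat>" "y \<in> \<rat>" "0 \<le> y" "y^2 = 1 + 70 * x^2 - 567 * x^4"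
proof -
  from assms obtain y where "x \<in> \<rat>" "y \<in> \<rat>" "y^2 = 1 + 70 * x^2 - 567 * x^4" by (auto simp: sq_points_def)
  then show ?thesis using that[of "\<bar>y\<bar>"] by auto
qed

lemma sq_points_uminus: "x \<in> sq_points \<Longrightarrow> - x \<in> sq_points"
  by (auto simp: sq_points_def)

text \<open>The leading coefficient of the quartic is negative, so its real locus is compact.\<close>

lemma sq_points_bounded:
  assumes "x \<in> sq_points" shows "\<bar>x\<bar> \<le> 1/2"
proof (rule ccontr)
  assume "\<not> \<bar>x\<bar> \<le> 1/2"
  then have "(1/2)^2 < \<bar>x\<bar>^2" by (intro power_strict_mono) auto
  then have x: "x^2 > 1/4" by (simp add: power2_eq_square)
  obtain y where "y^2 = 1 + 70 * x^2 - 567 * x^4" using assms by (auto simp: sq_points_def)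
  then have "1 + x^2 * (70 - 567 * x^2) = y^2" by (simp add: algebra_simps flip: power_add)
  then have "0 \<le> 1 + x^2 * (70 - 567 * x^2)" by simp
  moreover have "x^2 * (567 * x^2 - 70) > 1/4 * (567/4 - 70)" using x by (intro mult_strict_mono) auto
  ultimately show False by (simp add: algebra_simps)
qed

section \<open>Infinitely many points\<close>

text \<open>
  A relation, because real numbers have no canonical 2-adic valuation; the fraction need not be reduced.
\<close>

definition two_adic_order :: "nat \<Rightarrow> real \<Rightarrow> bool" where
  "two_adic_order m x \<longleftrightarrow> (\<exists>a b :: int. odd a \<and> odd b \<and> x = 2^m * of_int a / of_int b)"

lemma two_adic_order_unique:
  assumes "two_adic_order m x" "two_adic_order n x" shows "m = n"
proof -
  have *: False if "two_adic_order m x" "two_adic_order n x" "m < n" for m n x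
  proof -
    from that obtain a b c d :: int where h: "odd a" "odd b" "odd c" "odd d"
      "x = 2^m * of_int a / of_int b" "x = 2^n * of_int c / of_int d"
      unfolding two_adic_order_def by auto
    obtain k where k: "n = m + Suc k" using \<open>m < n\<close> less_iff_Suc_add by auto
    have "b \<noteq> 0" "d \<noteq> 0" using h by auto
    then have "(of_int a * of_int d :: real) = 2 * 2^k * of_int c * of_int b"
      using h(5,6) by (simp add: k field_simps power_add)
    then have "(of_int (a * d) :: real) = of_int (2 * 2^k * c * b)" by simp
    then have "a * d = 2 * 2^k * c * b" by (rule of_int_eq_iff[THEN iffD1])
    moreover have "odd (a * d)" using h by simp
    ultimately show False by simp
  qed
  show ?thesis using *[OF assms] *[OF assms(2,1)] by (meson linorder_neqE_nat)
qed

text \<open>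
  For \<open>x\<close> of positive 2-adic order, \<open>y\<^sup>2 = 1 + 70 x\<^sup>2 - 567 x\<^sup>4\<close> and the denominator \<open>1 + 567 x\<^sup>4\<close> are 2-adic units, so
  the duplication \<open>2 x y / (1 + 567 x\<^sup>4)\<close> contributes exactly one new factor 2.
\<close>

lemma sq_points_double:
  assumes "x \<in> sq_points" "0 < x" "two_adic_order m x" "0 < m"
  obtains z where "z \<in> sq_points" "0 < z" "two_adic_order (Suc m) z"
proof -
  obtain y where y: "x \<in> \<rat>" "y \<in> \<rat>" "0 \<le> y" "y^2 = 1 + 70 * x^2 - 567 * x^4"
    using assms(1) by (rule sq_pointsE)
  obtain a b :: int where ab: "odd a" "odd b" "x = 2^m * of_int a / of_int b"
    using assms(3) unfolding two_adic_order_def by auto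
  have b0: "b \<noteq> 0" using ab by auto
  let ?C = "b^4 + 70 * 2^(2*m) * a^2 * b^2 - 567 * 2^(4*m) * a^4"
  have "(y * of_int b ^ 2)^2 = of_int ?C"
    using b0 unfolding power_mult_distrib y(4) ab(3)
    by (simp add: field_simps power_mult flip: power_mult power_add)
  moreover have "y * of_int b ^ 2 \<in> \<rat>" using y by auto
  ultimately have "y * of_int b ^ 2 \<in> \<int>"
    using Rats_square_Ints Ints_of_int by metis
  then obtain c :: int where c: "y * of_int b ^ 2 = of_int c" by (auto elim: Ints_cases)
  have "(of_int (c^2) :: real) = of_int ?C" using \<open>(y * of_int b ^ 2)^2 = of_int ?C\<close> c by simp
  then have "c^2 = ?C" by (rule of_int_eq_iff[THEN iffD1])
  moreover have "odd ?C" using ab assms(4) by simp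
  ultimately have oc: "odd c" by (metis even_power zero_less_numeral)
  let ?z = "(x*y + x*y) / (1 + 567 * x^2 * x^2)"
  have z: "?z \<in> sq_points" using y by (intro sq_points_add) auto
  have pos: "1 + 567 * x^2 * x^2 > 0" by (intro add_pos_nonneg mult_nonneg_nonneg) auto
  have y': "y = of_int c / of_int b ^ 2" using c b0 by (simp add: field_simps)
  have "c \<noteq> 0" using oc by auto
  then have "y \<noteq> 0" unfolding y' using b0 by simp
  then have "y > 0" using y(3) by simp
  then have "?z > 0" using pos assms(2) by simp
  moreover have "two_adic_order (Suc m) ?z"
    unfolding two_adic_order_def
  proof (intro exI conjI)
    show "odd (a * c * b)" using ab oc by simp
    show "odd (b^4 + 567 * 2^(4*m) * a^4)" using ab assms(4) by simp
    have p2: "(of_int (b^4 + 567 * 2^(4*m) * a^4) :: real) \<noteq> 0"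
      by (metis \<open>odd (b^4 + 567 * 2^(4*m) * a^4)\<close> even_zero of_int_eq_0_iff)
    have e: "1 + 567 * x^2 * x^2 = of_int (b^4 + 567 * 2^(4*m) * a^4) / of_int b ^ 4"
      using b0 unfolding ab(3) by (simp add: field_simps flip: power_mult power_add)
    have e2: "x * y = 2^m * of_int a * of_int c / of_int b ^ 3"
      unfolding y' ab(3) by (simp add: field_simps flip: power_Suc power_add)
    show "?z = 2 ^ Suc m * of_int (a * c * b) / of_int (b^4 + 567 * 2^(4*m) * a^4)"
      unfolding e e2 using b0 p2 by (simp add: field_simps eval_nat_numeral)
  qed
  ultimately show ?thesis using z that by blast
qed

text \<open>
  The obvious point with \<open>x = 1/6\<close>, \<open>y = 19/12\<close> has negative 2-adic order; its double \<open>76/207\<close> has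
  order 2.
\<close>

lemma sq_points_seed: "(76/207::real) \<in> sq_points" "two_adic_order 2 (76/207)"
proof -
  have "((1/6)*(19/12) + (1/6)*(19/12)) / (1 + 567 * (1/6)^2 * (1/6)^2) \<in> sq_points"
    by (rule sq_points_add) (auto simp: power_divide)
  then show "(76/207::real) \<in> sq_points" by (simp add: power_divide)
  show "two_adic_order 2 (76/207)" unfolding two_adic_order_def
    by (rule exI[of _ 19], rule exI[of _ 207]) auto
qed

lemma sq_points_sequence:
  "\<exists>X :: nat \<Rightarrow> real. inj X \<and> (\<forall>n. X n \<in> sq_points \<and> 0 < X n)"
proof -
  have "\<exists>x. x \<in> sq_points \<and> 0 < x \<and> two_adic_order (n + 2) x" for n
  proof (induction n)
    case 0 show ?case using sq_points_seed by (intro exI[of _ "76/207"]) (auto simp: numeral_2_eq_2)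
  next
    case (Suc n) then show ?case by (metis sq_points_double add_Suc zero_less_Suc add_2_eq_Suc')
  qed
  then obtain X where X: "\<And>n. X n \<in> sq_points \<and> 0 < X n \<and> two_adic_order (n + 2) (X n)" by metis
  have "inj X" by (rule injI) (metis X two_adic_order_unique add_right_cancel)
  with X show ?thesis by blast
qed

section \<open>Density of the points\<close>

text \<open>
  Infinitely many points in a compact set accumulate. The difference of two consecutive terms of a convergent
  subsequence tends to the neutral element \<open>x = 0\<close>, without being equal to it.
\<close>

lemma small_sq_point:
  assumes "0 < \<delta>" shows "\<exists>e \<in> sq_points. 0 < e \<and> e < \<delta>"
proof -
  obtain X :: "nat \<Rightarrow> real" where X: "inj X" "\<And>n. X n \<in> sq_points" "\<And>n. 0 < X n"
    using sq_points_sequence by blast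
  have "bounded (range X)" unfolding bounded_iff using sq_points_bounded[OF X(2)]
    by (intro exI[of _ "1/2"]) auto
  then obtain l r where r: "strict_mono r" "(X \<circ> r) \<longlonglongrightarrow> l"
    using bounded_imp_convergent_subsequence by blast
  define F where "F x = sqrt (1 + 70 * x^2 - 567 * x^4)" for x
  define z where "z = X \<circ> r"
  have zl: "z \<longlonglongrightarrow> l" and zl': "(\<lambda>n. z (Suc n)) \<longlonglongrightarrow> l"
    using r(2) LIMSEQ_Suc[OF r(2)] unfolding z_def by auto
  \<comment> \<open>The group difference of consecutive points, all lifted to the branch \<open>y \<ge> 0\<close>.\<close>
  define D where "D n = (z (Suc n) * F (z n) + (- z n) * F (z (Suc n))) / (1 + 567 * (z (Suc n))^2 * (- z n)^2)" for n
  have pos: "1 + 567 * x^2 * y^2 > 0" for x y :: real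
    by (intro add_pos_nonneg mult_nonneg_nonneg) auto
  have "D \<longlonglongrightarrow> (l * F l + (- l) * F l) / (1 + 567 * l^2 * (- l)^2)"
    unfolding D_def F_def using pos[of l "-l"] by (intro tendsto_intros zl zl') auto
  then have "D \<longlonglongrightarrow> 0" by simp
  from LIMSEQ_D[OF this assms] obtain n where n: "\<bar>D n\<bar> < \<delta>" by auto
  have F: "F x \<in> \<rat> \<and> F x ^ 2 = 1 + 70 * x^2 - 567 * x^4" if "x \<in> sq_points" for x
    using that by (rule sq_pointsE) (metis F_def real_sqrt_unique)
  have zin: "z k \<in> sq_points" "z k \<in> \<rat>" "0 < z k" for k using X by (auto simp: z_def sq_points_def)
  have D: "D n \<in> sq_points"
    unfolding D_def using zin F[OF zin(1)] by (intro sq_points_add) auto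
  have "D n \<noteq> 0"
  proof
    assume "D n = 0"
    then have "z (Suc n) * F (z n) = z n * F (z (Suc n))"
      using pos[of "z (Suc n)" "- z n"] by (simp add: D_def)
    then have "(z (Suc n))^2 * F (z n)^2 = (z n)^2 * F (z (Suc n))^2" by (metis power_mult_distrib)
    \<comment> \<open>Substituting the quartic leaves a multiple of the difference of the squares.\<close>
    then have "((z (Suc n))^2 - (z n)^2) * (1 + 567 * (z (Suc n))^2 * (z n)^2) = 0"
      using F[OF zin(1)] by (simp add: algebra_simps flip: power_add)
    then have "z (Suc n) = z n" using pos[of "z (Suc n)" "z n"] zin(3)[of n] zin(3)[of "Suc n"]
      by (auto simp: power2_eq_iff)
    then show False using X(1) r(1) unfolding z_def by (simp add: inj_eq strict_mono_eq)
  qed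
  then have "0 < \<bar>D n\<bar>" by simp
  moreover have "\<bar>D n\<bar> \<in> sq_points" using D sq_points_uminus[OF D] by (simp add: abs_if)
  ultimately show ?thesis using n by blast
qed

text \<open>
  Since \<open>y \<ge> 1\<close> on \<open>[0, 1/3]\<close>, adding the point with small coordinate \<open>e\<close> moves \<open>p\<close> to the right by an
  amount comparable with \<open>e\<close>. The factors \<open>1/4\<close> and \<open>11\<close> are generous; what matters is that they are
  positive and independent of \<open>p\<close> and \<open>e\<close>.
\<close>

lemma sq_points_step:
  assumes e: "e \<in> sq_points" "0 < e" "e \<le> 1/100" and p: "p \<in> sq_points" "0 \<le> p" "p \<le> 1/3"
  shows "\<exists>p' \<in> sq_points. p + e/4 \<le> p' \<and> p' \<le> p + 11 * e"
proof -
  obtain Y where Y: "p \<in> \<rat>" "Y \<in> \<rat>" "0 \<le> Y" "Y^2 = 1 + 70 * p^2 - 567 * p^4" using p(1) by (rule sq_pointsE)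
  obtain H where H: "e \<in> \<rat>" "H \<in> \<rat>" "0 \<le> H" "H^2 = 1 + 70 * e^2 - 567 * e^4" using e(1) by (rule sq_pointsE)
  define d where "d = 1 + 567 * p^2 * e^2"
  define p' where "p' = (p*H + e*Y) / d"
  have in': "p' \<in> sq_points" unfolding p'_def d_def using Y H by (intro sq_points_add) auto
  have p2: "p^2 \<le> 1/9" using power_mono[OF p(3,2), of 2] by (simp add: power_divide)
  have e2: "e^2 \<le> e/100" using e(2,3) by (simp add: power2_eq_square)
  have Y1: "1 \<le> Y"
    using quartic_ge_1[OF p(2,3)] Y(3,4) by (intro power2_le_imp_le[of 1 Y]) auto
  have H1: "1 \<le> H"
    using quartic_ge_1[of e] e H(3,4) by (intro power2_le_imp_le[of 1 H]) auto
  have Y10: "Y \<le> 9"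
  proof -
    have "0 \<le> p^4" by simp
    then have "Y^2 \<le> 81" unfolding Y(4) using p2 by linarith
    then have "Y^2 \<le> 9^2" by simp
    then show ?thesis by (rule power2_le_imp_le) simp
  qed
  have H2: "H - 1 \<le> e"
  proof -
    have "H \<le> H^2" using H1 by (simp add: power2_eq_square)
    moreover have "0 \<le> e^4" by simp
    ultimately show ?thesis unfolding H(4) using e2 e(2) by linarith
  qed
  have pe: "p^2 * e^2 \<le> 1/9 * (e/100)" by (rule mult_mono) (use p2 e2 in auto)
  have d1: "1 \<le> d" "d \<le> 1 + 63 * (e/100)" unfolding d_def using pe by (auto simp: mult_ac)
  have dp: "p' * d = p*H + e*Y" using d1 by (simp add: p'_def)
  have "(p + e/4) * d \<le> p' * d"
  proof -
    have "(p + e/4) * d \<le> (p + e/4) * (1 + 63 * (e/100))" using d1 p e by (intro mult_left_mono) auto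
    also have "\<dots> = p + e/4 + 63/100 * (e * p) + 63/400 * e^2" by (simp add: algebra_simps power2_eq_square)
    also have "\<dots> \<le> p + e/4 + 63/300 * e + 63/40000 * e"
    proof -
      have "e * p \<le> e * (1/3)" using e(2) p(3) by (intro mult_left_mono) auto
      then show ?thesis using e2 by linarith
    qed
    also have "\<dots> \<le> p + e" using e(2) by simp
    also have "\<dots> \<le> p*H + e*Y"
    proof (rule add_mono)
      show "p \<le> p * H" using mult_left_mono[OF H1 p(2)] by simp
      show "e \<le> e * Y" using mult_left_mono[OF Y1, of e] e(2) by simp
    qed
    finally show ?thesis unfolding dp .
  qed
  moreover have "p' * d \<le> (p + 11 * e) * d"
  proof -
    have "p * (H - 1) \<le> 1/3 * e" using H1 H2 p(3) by (intro mult_mono) auto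
    then have "p * H \<le> p + e" using e(2) by (simp add: algebra_simps)
    moreover have "e * Y \<le> e * 9" using Y10 e(2) by (intro mult_left_mono) auto
    ultimately have "p * H + e * Y \<le> p + e + e * 9" by (rule add_mono)
    then have "p' * d \<le> (p + 11 * e) * 1" unfolding dp using e(2) by simp
    also have "\<dots> \<le> (p + 11 * e) * d" using d1 p e by (intro mult_left_mono) auto
    finally show ?thesis .
  qed
  ultimately show ?thesis using in' d1 by (intro bexI[of _ p']) auto
qed

lemma sq_points_dense:
  assumes "0 \<le> a" "a < b" "b \<le> 1/3"
  shows "\<exists>p \<in> sq_points. a < p \<and> p < b"
proof -
  obtain e where e: "e \<in> sq_points" "0 < e" "e < min (1/100) ((b - a) / 11)"
    using small_sq_point[of "min (1/100) ((b - a) / 11)"] assms by auto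
  \<comment> \<open>Walk from \<open>0\<close>: steps shorter than \<open>b - a\<close> cannot jump over the interval, and before
    reaching it the walk gains at least \<open>e/4\<close> each time.\<close>
  have "\<exists>p \<in> sq_points. (a < p \<and> p < b) \<or> (p \<le> a \<and> of_nat n * (e/4) \<le> p)" for n :: nat
  proof (induction n)
    case 0
    have "(0::real) \<in> sq_points" by (auto simp: sq_points_def intro!: bexI[of _ 1])
    then show ?case using assms by auto
  next
    case (Suc n)
    then obtain p where p: "p \<in> sq_points" "(a < p \<and> p < b) \<or> (p \<le> a \<and> of_nat n * (e/4) \<le> p)" by blast
    show ?case
    proof (cases "a < p \<and> p < b")
      case False
      then have q: "p \<le> a" "of_nat n * (e/4) \<le> p" using p by auto
      then have "0 \<le> p" using e by (meson divide_nonneg_nonneg dual_order.trans less_imp_le mult_nonneg_nonneg of_nat_0_le_iff zero_le_numeral)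
      then obtain p' where p': "p' \<in> sq_points" "p + e/4 \<le> p'" "p' \<le> p + 11 * e"
        using sq_points_step[of e p] e p q assms by force
      have "p' < b" using p' e q by (simp add: field_simps)
      moreover have "of_nat (Suc n) * (e/4) \<le> p'" using p' q by (simp add: algebra_simps)
      ultimately show ?thesis using p' by (cases "a < p'") auto
    qed (use p in blast)
  qed
  moreover obtain n :: nat where "of_nat n * (e/4) > a"
    using reals_Archimedean3[of "e/4"] e by auto
  ultimately show ?thesis by (metis not_le order_trans)
qed

section \<open>From the quartic to the cosines\<close>

text \<open>
  A root \<open>q\<close> of \<open>36 (r\<^sup>2 + q\<^sup>2) - 114 r q + 567 r\<^sup>2 q\<^sup>2 = 1\<close>, an equation quadratic in \<open>q\<close> whose discriminant is
  a square multiple of \<open>1 + 70 r\<^sup>2 - 567 r\<^sup>4\<close>. The symmetric curve in \<open>(r, q)\<close> comes from the two quadrics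
  \<open>v\<^sup>2 = 4 - 7 u\<^sup>2\<close> and \<open>w\<^sup>2 = (1 - u) (1 + 7 u)\<close>, which imply \<open>(2 w - v) (2 w + v) = u (24 - 21 u)\<close>, by putting
  \<open>r = (2 w + v) / (24 - 21 u)\<close> and \<open>q = (2 w - v) / (24 - 21 u)\<close>.
\<close>

definition partner_coord :: "real \<Rightarrow> real" where
  "partner_coord r = (57 * r + 6 * sqrt (1 + 70 * r^2 - 567 * r^4)) / (36 + 567 * r^2)"

text \<open>
  The coordinate \<open>u\<close> recovered from \<open>r\<close> and \<open>q\<close>: the relations above give \<open>r q (24 - 21 u) = u\<close>.
\<close>

definition base_cos :: "real \<Rightarrow> real" where
  "base_cos r = 24 * r * partner_coord r / (1 + 21 * r * partner_coord r)"

lemma partner_coord_pos: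
  assumes "0 \<le> r" "r \<le> 1/3" shows "0 < partner_coord r"
proof -
  have "0 < sqrt (1 + 70 * r^2 - 567 * r^4)" using quartic_ge_1[OF assms] by simp
  moreover have "0 < 36 + 567 * r^2" by (intro add_pos_nonneg) auto
  ultimately show ?thesis unfolding partner_coord_def
    using assms(1) by (intro divide_pos_pos add_nonneg_pos[of "57 * r"]) simp_all
qed

text \<open>
  Solving for the remaining coordinates gives \<open>v = 12 (r - q) / D\<close> and \<open>w = 6 (r + q) / D\<close> with
  \<open>D = 1 + 21 r q\<close>, rational as soon as \<open>r\<close> and \<open>q\<close> are; the two quadric equations then both reduce to the
  equation between \<open>r\<close> and \<open>q\<close>.
\<close>

lemma base_cos_squares:
  assumes r: "r \<in> sq_points" "0 \<le> r" "r \<le> 1/3"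
  defines "u \<equiv> base_cos r"
  shows "u \<in> \<rat>" "\<exists>v \<in> \<rat>. v^2 = 4 - 7 * u^2" "\<exists>w \<in> \<rat>. 0 \<le> w \<and> w^2 = (1 - u) * (1 + 7 * u)"
proof -
  obtain y where y: "r \<in> \<rat>" "y \<in> \<rat>" "0 \<le> y" "y^2 = 1 + 70 * r^2 - 567 * r^4"
    using r(1) by (rule sq_pointsE)
  have sq: "sqrt (1 + 70 * r^2 - 567 * r^4) = y" using y(3,4) by (metis real_sqrt_unique)
  define q where "q = partner_coord r"
  define D where "D = 1 + 21 * r * q"
  have q: "q \<in> \<rat>" unfolding q_def partner_coord_def sq using y by simp
  have q0: "0 < q" unfolding q_def using partner_coord_pos r by simp
  have D: "D > 0" unfolding D_def using q0 r by (intro add_pos_nonneg) auto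
  have DQ: "D \<in> \<rat>" unfolding D_def using q y by simp
  have u: "u = 24 * r * q / D" unfolding u_def base_cos_def D_def q_def by simp
  have "36 + 567 * r^2 > 0" by (intro add_pos_nonneg) auto
  then have "q * (36 + 567 * r^2) = 57 * r + 6 * y" unfolding q_def partner_coord_def sq by simp
  then have "(q * (36 + 567 * r^2) - 57 * r)^2 = 36 * (1 + 70 * r^2 - 567 * r^4)"
    using y(4) by (simp add: power_mult_distrib)
  \<comment> \<open>Completing the square multiplied the equation of the curve by its leading coefficient in \<open>q\<close>.\<close>
  then have "(36 + 567 * r^2) * (36 * (r^2 + q^2) - 114 * r * q + 567 * r^2 * q^2 - 1) = 0"
    by algebra
  then have curve: "36 * (r^2 + q^2) - 114 * r * q + 567 * r^2 * q^2 = 1"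
    using \<open>36 + 567 * r^2 > 0\<close> by simp
  show "u \<in> \<rat>" unfolding u using q DQ y by simp
  show "\<exists>v \<in> \<rat>. v^2 = 4 - 7 * u^2"
  proof
    show "12 * (r - q) / D \<in> \<rat>" using q DQ y by simp
    have "(12 * (r - q))^2 = 4 * D^2 - 7 * (24 * r * q)^2" unfolding D_def using curve by algebra
    then show "(12 * (r - q) / D)^2 = 4 - 7 * u^2"
      unfolding u power_divide using D by (simp add: field_simps)
  qed
  show "\<exists>w \<in> \<rat>. 0 \<le> w \<and> w^2 = (1 - u) * (1 + 7 * u)"
  proof (intro bexI conjI)
    show "6 * (r + q) / D \<in> \<rat>" using q DQ y by simp
    show "0 \<le> 6 * (r + q) / D" using q0 r D by simp
    have "(6 * (r + q))^2 = (D - 24 * r * q) * (D + 7 * (24 * r * q))" unfolding D_def using curve by algebra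
    then show "(6 * (r + q) / D)^2 = (1 - u) * (1 + 7 * u)"
      unfolding u power_divide using D by (simp add: field_simps power2_eq_square)
  qed
qed

lemma continuous_base_cos: "continuous_on {0..1/3} base_cos"
proof -
  have "36 + 567 * r^2 \<noteq> 0" for r :: real using zero_le_power2[of r] by linarith
  then have c: "continuous_on {0..1/3} partner_coord" unfolding partner_coord_def
    by (intro continuous_intros) auto
  have "1 + 21 * r * partner_coord r \<noteq> 0" if "r \<in> {0..1/3}" for r
  proof -
    have "0 \<le> 21 * r * partner_coord r" using partner_coord_pos[of r] that by simp
    then show ?thesis by linarith
  qed
  then show ?thesis unfolding base_cos_def by (intro continuous_intros c) auto
qed

lemma base_cos_endpoints: "base_cos 0 = 0" "base_cos (1/3) = 3/4"
proof -
  have "sqrt (1 + 70 * (1/3)^2 - 567 * (1/3)^4) = (4/3 :: real)"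
    by (rule real_sqrt_unique) (auto simp: power_divide)
  then have "partner_coord (1/3) = 3/11" unfolding partner_coord_def by (simp add: power_divide)
  then show "base_cos (1/3) = 3/4" unfolding base_cos_def by (simp only:) simp
qed (simp add: base_cos_def)

text \<open>
  By the intermediate value theorem every value in \<open>(0, 1)\<close> is attained by \<open>1 - 2 u\<^sup>2\<close> at some real parameter
  in \<open>(0, 1/3)\<close>, which is then approximated by parameters of rational points.
\<close>

lemma dense_cosines_with_squares:
  fixes a b :: real
  assumes "0 < a" "a < b" "b < 1"
  obtains u v w where "u \<in> \<rat>" "v \<in> \<rat>" "w \<in> \<rat>" "0 < u" "0 \<le> w"
    "v^2 = 4 - 7 * u^2" "w^2 = (1 - u) * (1 + 7 * u)" "a < 1 - 2 * u^2" "1 - 2 * u^2 < b"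
proof -
  define h where "h r = 1 - 2 * base_cos r ^ 2" for r
  have hc: "continuous_on {0..1/3} h" unfolding h_def by (intro continuous_intros continuous_base_cos)
  have h01: "h 0 = 1" "h (1/3) = -1/8" unfolding h_def base_cos_endpoints by (auto simp: power_divide)
  have "\<exists>r\<ge>0. r \<le> 1/3 \<and> h r = (a + b) / 2"
    by (rule IVT2') (use h01 hc assms in auto)
  then obtain r0 where r0: "0 \<le> r0" "r0 \<le> 1/3" "h r0 = (a + b)/2" by blast
  have "0 < h r0" "h r0 < 1" unfolding r0(3) using assms by auto
  then have "r0 \<noteq> 0" "r0 \<noteq> 1/3" using h01 by force+
  then have "0 < r0" "r0 < 1/3" using r0(1,2) by auto
  obtain d where d: "d > 0" "\<And>r. r \<in> {0..1/3} \<Longrightarrow> dist r r0 < d \<Longrightarrow> dist (h r) (h r0) < (b - a)/2"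
    using hc[unfolded continuous_on_iff, rule_format, of r0 "(b - a)/2"] r0 assms by auto
  obtain r where r: "r \<in> sq_points" "r0 < r" "r < min (r0 + d) (1/3)"
  proof -
    have "r0 < min (r0 + d) (1/3)" using \<open>r0 < 1/3\<close> d(1) by simp
    from sq_points_dense[OF r0(1) this min.cobounded2] that show ?thesis by blast
  qed
  have "r \<in> {0..1/3}" "dist r r0 < d" using r r0(1) by (auto simp: dist_real_def)
  then have "dist (h r) ((a + b)/2) < (b - a)/2" using d(2)[of r] unfolding r0(3) by blast
  then have "a < h r" "h r < b" unfolding dist_real_def abs_less_iff by (auto simp: field_simps)
  have ri: "0 \<le> r" "r \<le> 1/3" using r r0 by auto
  have "0 < base_cos r" unfolding base_cos_def
    using partner_coord_pos[OF ri] r r0 by (intro divide_pos_pos mult_pos_pos add_pos_pos) auto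
  then show ?thesis using that base_cos_squares[OF r(1) ri] \<open>a < h r\<close> \<open>h r < b\<close> unfolding h_def by metis
qed

section \<open>Isosceles triangles of perimeter two\<close>

text \<open>
  Dividing \<open>b'\<^sup>2 (1 - 2 b') = b\<^sup>2 (1 - 2 b)\<close> by \<open>b' - b\<close> leaves \<open>2 b'\<^sup>2 + (2 b - 1) b' + (2 b\<^sup>2 - b) = 0\<close>,
  whose discriminant is \<open>(1 - 2 b) (1 + 6 b) = (w / (1 + u))\<^sup>2\<close>; its positive root is the partner.
  It coincides with \<open>b\<close> only in the equilateral case \<open>u = 1/2\<close>.
\<close>

lemma equal_area_partner:
  fixes u w :: real
  assumes "u \<in> \<rat>" "w \<in> \<rat>" "0 < u" "u < 1" "u \<noteq> 1/2" "0 \<le> w" "w^2 = (1 - u) * (1 + 7 * u)"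
  defines "b \<equiv> u / (1 + u)"
  obtains b' where "b' \<in> \<rat>" "0 < b'" "b' < 1/2" "b' \<noteq> b" "b'^2 * (1 - 2 * b') = b^2 * (1 - 2 * b)"
proof
  let ?b = "(1 - u + w) / (4 * (1 + u))"
  show "?b \<in> \<rat>" using assms by simp
  show "0 < ?b" using assms by simp
  have "w^2 < (1 + 3 * u)^2" unfolding assms(7) using assms(3) by (simp add: power2_eq_square algebra_simps add_pos_pos)
  then have "w < 1 + 3 * u" by (rule power2_less_imp_less) (use assms in simp)
  then show "?b < 1/2" using assms by (simp add: field_simps)
  show "?b \<noteq> b"
  proof
    assume "?b = b"
    moreover have "b = 4 * u / (4 * (1 + u))" unfolding b_def using assms(3) by (simp add: divide_simps)
    ultimately have "1 - u + w = 4 * u" using assms(3) by simp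
    then have "w = 5 * u - 1" by simp
    then have "u * (2 * u - 1) = 0" using assms(7) by algebra
    then show False using assms by simp
  qed
  have "(1 - u + w)^2 * (2 * (1 + u) - (1 - u + w)) = 32 * u^2 * (1 - u)"
    using assms(7) by algebra
  moreover have frac: "(k / (4 * (1 + u)))^2 * (1 - 2 * (k / (4 * (1 + u))))
      = k^2 * (2 * (1 + u) - k) / (32 * (1 + u)^3)" for k
  proof -
    have "(k / (4 * l))^2 * (1 - 2 * (k / (4 * l))) = k^2 * (2 * l - k) / (32 * l^3)"
      if "l \<noteq> 0" for l :: real
      using that by (simp add: field_simps eval_nat_numeral)
    from this[of "1 + u"] show ?thesis using assms(3) by simp
  qed
  moreover have "b = 4 * u / (4 * (1 + u))" unfolding b_def using assms(3) by (simp add: divide_simps)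
  moreover have "(4 * u)^2 * (2 * (1 + u) - 4 * u) = 32 * u^2 * (1 - u)" by algebra
  ultimately show "?b^2 * (1 - 2 * ?b) = b^2 * (1 - 2 * b)" by (simp only:)
qed

text \<open>
  The height \<open>sqrt (1 - 2 b)\<close> makes the legs equal to \<open>1 - b\<close>, and hence the perimeter equal to 2.
\<close>

definition iso_triangle :: "real \<Rightarrow> triangle" where
  "iso_triangle b = (vector [0, sqrt (1 - 2 * b)], vector [- b, 0], vector [b, 0])"

lemma norm_vec2: "norm (x :: real^2) = sqrt ((x$1)^2 + (x$2)^2)"
  by (simp add: norm_vec_def L2_set_def sum_2)

lemma inner_vec2: "(x :: real^2) \<bullet> y = x$1 * y$1 + x$2 * y$2"
  by (simp add: inner_vec_def sum_2)

lemma sum_dist_vertices: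
  fixes \<phi> :: "real \<Rightarrow> real"
  assumes "\<phi> 0 = 0" "A \<noteq> B" "B \<noteq> C" "C \<noteq> A"
  shows "(\<Sum>x\<in>vertices (A, B, C). \<Sum>y\<in>vertices (A, B, C). \<phi> (dist x y))
     = 2 * (\<phi> (dist A B) + \<phi> (dist B C) + \<phi> (dist C A))"
  using assms by (simp add: dist_commute insert_absorb algebra_simps)

text \<open>
  An isometry preserves the multiset of side lengths. Sums of an arbitrary function over the sides encode
  this multiset; summing over all ordered pairs of vertices makes the labelling irrelevant, and
  \<open>\<phi> 0 = 0\<close> removes the diagonal.
\<close>

lemma congruent_sum_sides:
  fixes \<phi> :: "real \<Rightarrow> real"
  assumes "congruent (A, B, C) (A', B', C')" and "\<phi> 0 = 0"
    and "A \<noteq> B" "B \<noteq> C" "C \<noteq> A" "A' \<noteq> B'" "B' \<noteq> C'" "C' \<noteq> A'"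
  shows "\<phi> (dist A B) + \<phi> (dist B C) + \<phi> (dist C A)
       = \<phi> (dist A' B') + \<phi> (dist B' C') + \<phi> (dist C' A')"
proof -
  obtain f :: "real^2 \<Rightarrow> real^2" where f: "\<And>x y. dist (f x) (f y) = dist x y"
    "f ` vertices (A, B, C) = vertices (A', B', C')"
    using assms(1) unfolding congruent_def by blast
  have "inj f" by (rule injI) (metis f(1) dist_eq_0_iff)
  then have i: "inj_on f S" for S by (rule inj_on_subset) simp
  have "(\<Sum>x\<in>vertices (A', B', C'). \<Sum>y\<in>vertices (A', B', C'). \<phi> (dist x y))
     = (\<Sum>x\<in>vertices (A, B, C). \<Sum>y\<in>vertices (A, B, C). \<phi> (dist x y))"
    unfolding f(2)[symmetric] sum.reindex[OF i] by (simp add: f(1))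
  then show ?thesis using assms by (simp add: sum_dist_vertices del: vertices.simps)
qed

context
  fixes b :: real
  assumes b: "0 < b" "b < 1/2"
begin

lemma iso_dist:
  "dist (vector [0, sqrt (1 - 2 * b)] :: real^2) (vector [- b, 0]) = 1 - b"
  "dist (vector [- b, 0] :: real^2) (vector [b, 0]) = 2 * b"
  "dist (vector [b, 0] :: real^2) (vector [0, sqrt (1 - 2 * b)]) = 1 - b"
proof -
  have "sqrt (b^2 + (1 - 2 * b)) = 1 - b"
    by (rule real_sqrt_unique) (use b in \<open>auto simp: power2_eq_square algebra_simps\<close>)
  then show "dist (vector [0, sqrt (1 - 2 * b)] :: real^2) (vector [- b, 0]) = 1 - b"
    "dist (vector [b, 0] :: real^2) (vector [0, sqrt (1 - 2 * b)]) = 1 - b"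
    using b by (auto simp: dist_norm norm_vec2)
  have "sqrt ((2 * b)^2) = 2 * b" using b by (intro real_sqrt_abs[THEN trans]) auto
  then show "dist (vector [- b, 0] :: real^2) (vector [b, 0]) = 2 * b"
    using b by (simp add: dist_norm norm_vec2)
qed

lemma iso_perimeter: "perimeter (iso_triangle b) = 2"
  by (simp add: iso_triangle_def iso_dist)

lemma iso_area: "area (iso_triangle b) = b * sqrt (1 - 2 * b)"
proof -
  \<comment> \<open>On the Borel sets the Lebesgue measure is the content for which the shoelace formula is stated.\<close>
  have "compact (convex hull {vector [0, sqrt (1 - 2 * b)], vector [- b, 0], vector [b, 0]} :: (real^2) set)"
    by (intro compact_convex_hull) auto
  then have "convex hull {vector [0, sqrt (1 - 2 * b)], vector [- b, 0], vector [b, 0]} \<in> sets (lborel :: (real^2) measure)"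
    by (simp add: borel_compact)
  then show ?thesis using b by (simp add: area_def iso_triangle_def content_triangle abs_mult)
qed

lemma iso_distinct: "(vector [0, sqrt (1 - 2 * b)] :: real^2) \<noteq> vector [- b, 0]"
  "(vector [- b, 0] :: real^2) \<noteq> vector [b, 0]" "(vector [b, 0] :: real^2) \<noteq> vector [0, sqrt (1 - 2 * b)]"
  using iso_dist b by auto

lemma iso_nondegenerate: "nondegenerate (iso_triangle b)"
proof -
  have False if "collinear {vector [0, sqrt (1 - 2 * b)], vector [- b, 0], vector [b, 0] :: real^2}"
  proof -
    from that obtain u :: "real^2" where u: "\<And>x y. x \<in> {vector [0, sqrt (1 - 2 * b)], vector [- b, 0], vector [b, 0]} \<Longrightarrow> y \<in> {vector [0, sqrt (1 - 2 * b)], vector [- b, 0], vector [b, 0]} \<Longrightarrow> \<exists>c. x - y = c *\<^sub>R u"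
      unfolding collinear_def by blast
    obtain c where c: "vector [b, 0] - vector [- b, 0] = c *\<^sub>R u" using u by blast
    obtain c' where c': "vector [0, sqrt (1 - 2 * b)] - vector [- b, 0] = c' *\<^sub>R u" using u by blast
    have "c * u $ 1 = 2 * b" "c * u $ 2 = 0" "c' * u $ 2 = sqrt (1 - 2 * b)"
      using arg_cong[OF c, of "\<lambda>x. x $ 1"] arg_cong[OF c, of "\<lambda>x. x $ 2"] arg_cong[OF c', of "\<lambda>x. x $ 2"]
      by simp_all
    then show False using b by auto
  qed
  then show ?thesis unfolding nondegenerate_def iso_triangle_def by auto
qed

lemma iso_rational: "b \<in> \<rat> \<Longrightarrow> rational_sides (iso_triangle b)"
  by (simp add: iso_triangle_def iso_dist)

lemma iso_isosceles: "isosceles (iso_triangle b)"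
  unfolding isosceles_def iso_triangle_def labellings.simps
  by (rule bexI[of _ "(vector [0, sqrt (1 - 2 * b)], vector [- b, 0], vector [b, 0])"])
    (use iso_dist in \<open>auto simp: dist_commute\<close>)

lemma iso_base_angle: "has_base_angle (iso_triangle b) (arccos (b / (1 - b)))"
proof -
  have "angle (vector [0, sqrt (1 - 2 * b)]) (vector [- b, 0]) (vector [b, 0]) = arccos (b / (1 - b))"
  proof -
    have n: "norm (vector [0, sqrt (1 - 2 * b)] - vector [- b, 0] :: real^2) = 1 - b"
      "norm (vector [b, 0] - vector [- b, 0] :: real^2) = 2 * b"
      using iso_dist(1,2) unfolding dist_norm by (simp_all add: norm_minus_commute)
    have "b * (2 * b) / ((1 - b) * (2 * b)) = b / (1 - b)" using b by simp
    then show ?thesis unfolding angle_def n by (simp add: inner_vec2)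
  qed
  then show ?thesis unfolding has_base_angle_def iso_triangle_def labellings.simps
    by (intro bexI[of _ "(vector [0, sqrt (1 - 2 * b)], vector [- b, 0], vector [b, 0])"])
     (use iso_dist in \<open>auto simp: dist_commute\<close>)
qed

lemma iso_apex_angle: "has_apex_angle (iso_triangle b) (arccos (1 - 2 * (b / (1 - b))^2))"
proof -
  have "angle (vector [- b, 0]) (vector [0, sqrt (1 - 2 * b)]) (vector [b, 0]) = arccos (1 - 2 * (b / (1 - b))^2)"
  proof -
    have n: "norm (vector [- b, 0] - vector [0, sqrt (1 - 2 * b)] :: real^2) = 1 - b"
      "norm (vector [b, 0] - vector [0, sqrt (1 - 2 * b)] :: real^2) = 1 - b"
      using iso_dist(1,3) unfolding dist_norm by (simp_all add: norm_minus_commute)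
    have "((1 - 2 * b) - b^2) / (1 - b)^2 = 1 - 2 * (b / (1 - b))^2"
    proof -
      have "(1 - 2 * b) - b^2 = (1 - b)^2 - 2 * b^2" by (simp add: power2_eq_square algebra_simps)
      moreover have "(1 - b)^2 \<noteq> 0" using b by simp
      ultimately show ?thesis by (simp only: power_divide diff_divide_distrib) simp
    qed
    then show ?thesis unfolding angle_def n using b by (simp add: inner_vec2 power2_eq_square)
  qed
  then show ?thesis unfolding has_apex_angle_def iso_triangle_def labellings.simps
    by (intro bexI[of _ "(vector [0, sqrt (1 - 2 * b)], vector [- b, 0], vector [b, 0])"])
     (use iso_dist in \<open>auto simp: dist_commute\<close>)
qed

end

text \<open>
  Equality of perimeters forces \<open>c = 1\<close>. A nonnegative function that vanishes precisely at \<open>0\<close> and at the side lengths of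
  the first triangle then shows that the sides of the second are among those of the first.
\<close>

lemma congruent_iso_scaled_iso:
  assumes b: "0 < b" "b < 1/2" and b': "0 < b'" "b' < 1/2" and c: "0 < c"
    and cong: "congruent (iso_triangle b') (scale_triangle c (iso_triangle b))"
  shows "c = 1 \<and> b' = b"
proof -
  note d = iso_dist[OF b] iso_dist[OF b']
  have sc: "dist (c *\<^sub>R x) (c *\<^sub>R y) = c * dist x y" for x y :: "real^2"
    using c by (simp add: dist_norm flip: scaleR_diff_right)
  have *: "\<phi> (1 - b') + \<phi> (2 * b') + \<phi> (1 - b') = \<phi> (c * (1 - b)) + \<phi> (c * (2 * b)) + \<phi> (c * (1 - b))"
    if "\<phi> 0 = 0" for \<phi> :: "real \<Rightarrow> real"
    using congruent_sum_sides[OF cong[unfolded iso_triangle_def scale_triangle.simps], of \<phi>, OF that]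
      iso_distinct[OF b] iso_distinct[OF b'] c unfolding sc d by simp
  have c1: "c = 1" using *[of "\<lambda>x. x"] by (simp add: algebra_simps)
  define \<phi> where "\<phi> x = (x * (x - (1 - b')) * (x - 2 * b'))^2" for x
  have "\<phi> (1 - b) + \<phi> (2 * b) + \<phi> (1 - b) = 0" using *[of \<phi>] c1 by (simp add: \<phi>_def)
  moreover have "0 \<le> \<phi> x" for x by (simp add: \<phi>_def)
  ultimately have "\<phi> (1 - b) = 0" "\<phi> (2 * b) = 0" by (smt (verit))+
  then have "(1 - b = 1 - b' \<or> 1 - b = 2 * b') \<and> (2 * b = 1 - b' \<or> 2 * b = 2 * b')"
    using b by (auto simp: \<phi>_def)
  \<comment> \<open>Exchanging legs and base is possible only for \<open>b = b' = 1/3\<close>.\<close>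
  then have "b' = b" by (elim conjE disjE) linarith+
  then show ?thesis using c1 by simp
qed

lemma not_congruent_iso:
  assumes "0 < b" "b < 1/2" "0 < b'" "b' < 1/2" "b' \<noteq> b"
  shows "\<not> congruent (iso_triangle b') (iso_triangle b)"
  using congruent_iso_scaled_iso[of b b' 1] assms by (auto simp: iso_triangle_def)

lemma has_apex_imp_has_angle: "has_apex_angle T \<theta> \<Longrightarrow> has_angle T \<theta>"
  unfolding has_apex_angle_def has_angle_def by blast

lemma has_base_imp_has_angle: "has_base_angle T \<theta> \<Longrightarrow> has_angle T \<theta>"
  unfolding has_base_angle_def has_angle_def by (cases T) auto

section \<open>Genuine pairs in both families\<close>

text \<open>
  The partner depends only on the triangle, not on which of its angles is singled out, so this
  serves the apex and the base family alike.
\<close>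

lemma genuine_pair_iso:
  assumes "u \<in> \<rat>" "w \<in> \<rat>" "0 < u" "u < 1" "u \<noteq> 1/2" "0 \<le> w" "w^2 = (1 - u) * (1 + 7 * u)"
  obtains I where "\<And>\<rho>. has_angle (iso_triangle (u / (1 + u))) (arccos \<rho>) \<Longrightarrow> genuine_pair \<rho> (iso_triangle (u / (1 + u)), I)"
proof -
  define b where "b = u / (1 + u)"
  have b: "b \<in> \<rat>" "0 < b" "b < 1/2" using assms unfolding b_def by (auto simp: field_simps)
  obtain b' where b': "b' \<in> \<rat>" "0 < b'" "b' < 1/2" "b' \<noteq> b" "b'^2 * (1 - 2 * b') = b^2 * (1 - 2 * b)"
    using equal_area_partner[OF assms] unfolding b_def by metis
  have "x * sqrt (1 - 2 * x) = sqrt (x^2 * (1 - 2 * x))" if "0 < x" for x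
    using that by (simp add: real_sqrt_mult)
  then have "area (iso_triangle b) = area (iso_triangle b')"
    unfolding iso_area[OF b(2,3)] iso_area[OF b'(2,3)] using b(2) b'(2,5) by metis
  then have "genuine_pair \<rho> (iso_triangle b, iso_triangle b')" if "has_angle (iso_triangle b) (arccos \<rho>)" for \<rho>
    using that b b' not_congruent_iso[of b' b]
    by (simp add: iso_nondegenerate iso_rational iso_isosceles iso_perimeter)
  then show ?thesis using that unfolding b_def by blast
qed

text \<open>
  The angle with cosine \<open>\<rho>\<close> is the apex angle of the triangle with base cosine \<open>u\<close>, and a base angle of the
  triangle with base cosine \<open>\<rho>\<close>. The two triangles would be similar only for \<open>u = \<rho>\<close>, which means
  \<open>u = 1/2\<close>, the equilateral case.
\<close>

lemma apex_and_base_pair: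
  assumes "u \<in> \<rat>" "v \<in> \<rat>" "w \<in> \<rat>" "0 < u" "0 \<le> w"
    "v^2 = 4 - 7 * u^2" "w^2 = (1 - u) * (1 + 7 * u)"
  defines "\<rho> \<equiv> 1 - 2 * u^2"
  assumes \<rho>: "0 < \<rho>" "\<rho> \<noteq> 1/2"
  obtains p q where "apex_family \<rho> p" "base_family \<rho> q" "\<not> same_pair p q"
proof -
  have "u^2 < 1^2" using \<rho> unfolding \<rho>_def by simp
  then have u1: "u < 1" by (rule power2_less_imp_less) simp
  have u2: "u \<noteq> 1/2"
  proof
    assume "u = 1/2"
    then have "\<rho> = 1/2" unfolding \<rho>_def by (simp only: power_divide) simp
    then show False using \<rho>(2) by simp
  qed
  have rw: "(2 * u * \<bar>v\<bar>)^2 = (1 - \<rho>) * (1 + 7 * \<rho>)"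
    using assms(6) unfolding \<rho>_def power_mult_distrib power2_abs by algebra
  have r1: "\<rho> < 1" "\<rho> \<in> \<rat>" using assms unfolding \<rho>_def by auto
  obtain I where I: "\<And>\<rho>. has_angle (iso_triangle (u / (1 + u))) (arccos \<rho>) \<Longrightarrow> genuine_pair \<rho> (iso_triangle (u / (1 + u)), I)"
    using genuine_pair_iso[OF assms(1,3,4) u1 u2 assms(5,7)] by metis
  obtain J where J: "\<And>\<sigma>. has_angle (iso_triangle (\<rho> / (1 + \<rho>))) (arccos \<sigma>) \<Longrightarrow> genuine_pair \<sigma> (iso_triangle (\<rho> / (1 + \<rho>)), J)"
    using genuine_pair_iso[OF r1(2) _ \<rho>(1) r1(1) \<rho>(2) _ rw] assms(1,2,4) by auto
  have b: "0 < u / (1 + u)" "u / (1 + u) < 1/2" "0 < \<rho> / (1 + \<rho>)" "\<rho> / (1 + \<rho>) < 1/2"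
    using assms(4) u1 r1 \<rho>(1) by (auto simp: field_simps)
  have eq: "u / (1 + u) / (1 - u / (1 + u)) = u" "\<rho> / (1 + \<rho>) / (1 - \<rho> / (1 + \<rho>)) = \<rho>"
    using assms(4) \<rho>(1) by (auto simp: field_simps)
  have T: "has_apex_angle (iso_triangle (u / (1 + u))) (arccos \<rho>)"
    using iso_apex_angle[OF b(1,2)] unfolding eq \<rho>_def .
  have T': "has_base_angle (iso_triangle (\<rho> / (1 + \<rho>))) (arccos \<rho>)"
    using iso_base_angle[OF b(3,4)] unfolding eq .
  have "u \<noteq> \<rho>"
  proof
    assume "u = \<rho>"
    then have "(2 * u - 1) * (u + 1) = 0" unfolding \<rho>_def by algebra
    then show False using u2 assms(4) by simp
  qed
  then have ne: "u / (1 + u) \<noteq> \<rho> / (1 + \<rho>)" using assms(4) \<rho>(1) by (simp add: field_simps)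
  show ?thesis
  proof
    show "apex_family \<rho> (iso_triangle (u / (1 + u)), I)"
      using I[OF has_apex_imp_has_angle[OF T]] T unfolding apex_family_def fst_conv by blast
    show "base_family \<rho> (iso_triangle (\<rho> / (1 + \<rho>)), J)"
      using J[OF has_base_imp_has_angle[OF T']] T' unfolding base_family_def fst_conv by blast
    show "\<not> same_pair (iso_triangle (u / (1 + u)), I) (iso_triangle (\<rho> / (1 + \<rho>)), J)"
      using congruent_iso_scaled_iso[OF b] ne by auto
  qed
qed

theorem theorem5p7:
  shows "{0<..<1} \<subseteq> closure {\<rho> :: real. \<rho> \<in> \<rat> \<and> 0 < \<rho> \<and> \<rho> < 1 \<and>
           (\<exists>p q. genuine_pair \<rho> p \<and> genuine_pair \<rho> q \<and> \<not> same_pair p q)}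
       \<and> {0<..<1} \<subseteq> closure {\<rho> :: real. \<rho> \<in> \<rat> \<and> 0 < \<rho> \<and> \<rho> < 1 \<and>
           (\<exists>p q. apex_family \<rho> p \<and> base_family \<rho> q \<and> \<not> same_pair p q)}"
    (is "_ \<subseteq> closure ?G \<and> _ \<subseteq> closure ?F")
proof -
  have "?F \<subseteq> ?G" unfolding apex_family_def base_family_def by blast
  moreover have "{0<..<1} \<subseteq> closure ?F"
  proof
    fix x :: real assume x: "x \<in> {0<..<1}"
    show "x \<in> closure ?F" unfolding closure_approachable
    proof (intro allI impI)
      fix e :: real assume e: "0 < e"
      \<comment> \<open>The interval avoids the equilateral value \<open>1/2\<close>.\<close>
      obtain a b where ab: "0 < a" "a < b" "b < 1" "x - e < a" "b < x + e" "b \<le> 1/2 \<or> 1/2 \<le> a"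
      proof (cases "x < 1/2")
        case True
        then show ?thesis using that[of x "min (x + e/2) (1/2)"] x e by (auto simp: min_def split: if_splits)
      next
        case False
        then show ?thesis using that[of x "min (x + e/2) ((x + 1)/2)"] x e by (auto simp: min_def split: if_splits)
      qed
      obtain u v w where u: "u \<in> \<rat>" "v \<in> \<rat>" "w \<in> \<rat>" "0 < u" "0 \<le> w"
        "v^2 = 4 - 7 * u^2" "w^2 = (1 - u) * (1 + 7 * u)" "a < 1 - 2 * u^2" "1 - 2 * u^2 < b"
        using dense_cosines_with_squares[OF ab(1-3)] by metis
      have rho: "0 < 1 - 2 * u^2" "1 - 2 * u^2 \<noteq> 1/2" "1 - 2 * u^2 < 1" using u(8,9) ab by linarith+
      obtain p q where "apex_family (1 - 2 * u^2) p" "base_family (1 - 2 * u^2) q" "\<not> same_pair p q"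
        using apex_and_base_pair[OF u(1-7) rho(1,2)] by blast
      moreover have "1 - 2 * u^2 \<in> \<rat>" using u(1) by simp
      ultimately have "1 - 2 * u^2 \<in> ?F" using rho by blast
      moreover have "dist (1 - 2 * u^2) x < e" using u(8,9) ab by (auto simp: dist_real_def abs_less_iff)
      ultimately show "\<exists>y\<in>?F. dist y x < e" by blast
    qed
  qed
  ultimately show ?thesis using closure_mono by blast
qed

end
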